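(* Let $C_1,C_2$ be nonempty closed convex subsets of a real Hilbert space $\mathcal H$ and let $\lambda_1,\lambda_2>0$ with $\lambda_1+\lambda_2=1$. Let $$g(x,y):=\iota_{C_1}(x)+\iota_{C_2}(y)+\tfrac12\|x-y\|^2,\quad g_1(x):=\iota_{C_1}(x)+\tfrac12d_{C_2}^2(x),\quad g_2(y):=\tfrac12d_{C_1}^2(y)+\iota_{C_2}(y),$$ $$g_3(z):=\lambda_1\tfrac12d_{C_1}^2(z)+\lambda_2\tfrac12d_{C_2}^2(z),$$ let $S:=\{(x,y):x=P_{C_1}y,\ y=P_{C_2}x\}$, $E:=\operatorname{Fix}(P_{C_1}P_{C_2})$, $F:=\operatorname{Fix}(P_{C_2}P_{C_1})$, and let $\bar\phi$ be the unique minimizer over $\phi\in\mathcal H$ of $\sigma_{C_2-C_1}(\phi)+\frac12\|\phi\|^2$. Then $$S=\operatorname{argmin}g,\qquad E=\operatorname{argmin}g_1,\qquad F=\operatorname{argmin}g_2,\qquad \operatorname{argmin}g_3=\{z: z=\lambda_1P_{C_1}(z)+\lambda_2P_{C_2}(z)\}.$$ Moreover: (i) The mapping $T:S\to\operatorname{Fix}(\lambda_1P_{C_1}+\lambda_2P_{C_2})$, $T(x,y)=\lambda_1x+\lambda_2y$, is a homeomorphism with inverse $T^{-1}(z)=(P_{C_1}(z),P_{C_2}(z))$ for every $z\in\operatorname{Fix}(\lambda_1P_{C_1}+\lambda_2P_{C_2})$. Hence $\operatorname{Fix}(\lambda_1P_{C_1}+\lambda_2P_{C_2})=L(S)$, where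 $L:\mathcal H\times\mathcal H\to\mathcal H:(x,y)\mapsto\lambda_1x+\lambda_2y$. (ii) The mapping $H_1:E\to\operatorname{Fix}(\lambda_1P_{C_1}+\lambda_2P_{C_2})$, $H_1(x)=\lambda_1x+\lambda_2P_{C_2}x=x-\lambda_2\bar\phi$, is a homeomorphism with inverse $H_1^{-1}(z)=P_{C_1}(z)$ for every $z\in\operatorname{Fix}(\lambda_1P_{C_1}+\lambda_2P_{C_2})$. Hence $\operatorname{Fix}(\lambda_1P_{C_1}+\lambda_2P_{C_2})=E-\lambda_2\bar\phi$. (iii) The mapping $H_2:F\to\operatorname{Fix}(\lambda_1P_{C_1}+\lambda_2P_{C_2})$, $H_2(y)=\lambda_1P_{C_1}(y)+\lambda_2y=\lambda_1\bar\phi+y$, is a homeomorphism with inverse $H_2^{-1}(z)=P_{C_2}(z)$ for every $z\in\operatorname{Fix}(\lambda_1P_{C_1}+\lambda_2P_{C_2})$. Hence $\operatorname{Fix}(\lambda_1P_{C_1}+\lambda_2P_{C_2})=F+\lambda_1\bar\phi$. (iv) $\operatorname{Fix}(\lambda_1P_{C_1}+\lambda_2P_{C_2})=\lambda_1E+\lambda_2F$.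
   Context: $\iota_C$ is the indicator function ($0$ on $C$, $+\infty$ elsewhere), $d_C(x)=\inf_{y\in C}\|x-y\|$, $P_C$ is the metric projection onto $C$, and $\sigma_{C_2-C_1}(\phi)=\sup\{\langle\phi,y-x\rangle:x\in C_1,y\in C_2\}$. The minimizer $\bar\phi$ exists and is unique; in fact $\bar\phi=-P_{\overline{C_2-C_1}}(0)$. $\operatorname{Fix}T=\{x:Tx=x\}$; $\operatorname{argmin}$ is the (possibly empty) set of minimizers. A homeomorphism is a continuous bijection with continuous inverse (norm topologies). Sums of sets are Minkowski sums. *)

theory Defs
  imports "HOL-Analysis.Analysis"
begin

text \<open>A real Hilbert space is a type of sort \<open>{real_inner, complete_space}\<close>. The library constant
  \<^const>\<open>closest_point\<close> needs \<open>heine_borel\<close>, hence finite dimension, so it does not apply here.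
  The distance function of a nonempty set \<open>C\<close> is \<open>\<lambda>x. infdist x C\<close>.\<close>

definition proj :: "'a::{real_inner,complete_space} set \<Rightarrow> 'a \<Rightarrow> 'a"
  where "proj C x = (THE p. p \<in> C \<and> (\<forall>y\<in>C. dist x p \<le> dist x y))"

definition iota :: "'a set \<Rightarrow> 'a \<Rightarrow> ereal"
  where "iota C x = (if x \<in> C then 0 else \<infinity>)"

definition support_fun :: "'a::real_inner set \<Rightarrow> 'a \<Rightarrow> ereal"
  where "support_fun D \<phi> = (SUP d\<in>D. ereal (\<phi> \<bullet> d))"

definition argmin :: "('a \<Rightarrow> 'b::linorder) \<Rightarrow> 'a set"
  where "argmin f = {x. \<forall>y. f x \<le> f y}"

definition Fix :: "('a \<Rightarrow> 'a) \<Rightarrow> 'a set"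
  where "Fix T = {x. T x = x}"

text \<open>The binary minus on sets is set difference, so the Minkowski difference \<open>C2 - C1\<close> is
  written out as a set comprehension.\<close>

definition gap_objective :: "'a::real_inner set \<Rightarrow> 'a set \<Rightarrow> 'a \<Rightarrow> ereal"
  where "gap_objective C1 C2 \<phi> =
    support_fun {y - x | x y. x \<in> C1 \<and> y \<in> C2} \<phi> + ereal (1/2 * (norm \<phi>)\<^sup>2)"

definition gap_vector :: "'a::{real_inner,complete_space} set \<Rightarrow> 'a set \<Rightarrow> 'a"
  where "gap_vector C1 C2 = (THE \<phi>. \<phi> \<in> argmin (gap_objective C1 C2))"


text \<open>Both definite descriptions are well defined under the standing assumptions.\<close>

lemma nearest_point_exists:
  fixes C :: "'a::{real_inner,complete_space} set"
  assumes "closed C" "convex C" "C \<noteq> {}"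
  shows "\<exists>p\<in>C. \<forall>y\<in>C. dist x p \<le> dist x y"
proof -
  define d where "d = infdist x C"
  have d0: "d \<ge> 0" by (simp add: d_def infdist_nonneg)
  have dle: "d \<le> dist x y" if "y \<in> C" for y
    using that by (simp add: d_def infdist_le)
  have "\<exists>y\<in>C. dist x y < d + 1 / real (Suc n)" for n
  proof (rule ccontr)
    assume "\<not> ?thesis"
    then have "d + 1 / real (Suc n) \<le> (INF y\<in>C. dist x y)"
      using assms(3) by (intro cINF_greatest) (auto simp: not_less)
    then show False using assms(3) by (simp add: d_def infdist_notempty)
  qed
  then obtain s where sC: "\<And>n. s n \<in> C" and sd: "\<And>n. dist x (s n) < d + 1 / real (Suc n)"
    by metis
  have lim: "(\<lambda>n. dist x (s n)) \<longlonglongrightarrow> d"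
  proof (rule tendsto_sandwich[of "\<lambda>_. d" _ _ "\<lambda>n. d + 1 / real (Suc n)"])
    show "(\<lambda>n. d + 1 / real (Suc n)) \<longlonglongrightarrow> d"
      using tendsto_add[OF tendsto_const LIMSEQ_inverse_real_of_nat, of d]
      by (simp add: inverse_eq_divide)
  qed (use dle[OF sC] less_imp_le[OF sd] in \<open>simp_all del: of_nat_Suc\<close>)
  have par: "(dist (s m) (s n))\<^sup>2 \<le> 2 * (dist x (s m))\<^sup>2 + 2 * (dist x (s n))\<^sup>2 - 4 * d\<^sup>2" for m n
  proof -
    have "(1/2) *\<^sub>R s m + (1/2) *\<^sub>R s n \<in> C"
      using convexD[OF assms(2) sC sC, of "1/2" "1/2"] by simp
    then have "d\<^sup>2 \<le> (dist x ((1/2) *\<^sub>R s m + (1/2) *\<^sub>R s n))\<^sup>2"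
      using dle d0 by (intro power_mono) auto
    then show ?thesis
      by (simp add: dist_norm power2_norm_eq_inner inner_diff_left inner_diff_right
          inner_add_left inner_add_right inner_commute algebra_simps)
  qed
  have "Cauchy s"
  proof (rule metric_CauchyI)
    fix e :: real assume e: "e > 0"
    have "(\<lambda>n. (dist x (s n))\<^sup>2) \<longlonglongrightarrow> d\<^sup>2" using lim by (intro tendsto_power)
    moreover have "d\<^sup>2 < d\<^sup>2 + e\<^sup>2 / 4" using e by simp
    ultimately have "\<forall>\<^sub>F n in sequentially. (dist x (s n))\<^sup>2 < d\<^sup>2 + e\<^sup>2 / 4"
      by (rule order_tendstoD)
    then obtain N where N: "\<And>n. n \<ge> N \<Longrightarrow> (dist x (s n))\<^sup>2 < d\<^sup>2 + e\<^sup>2 / 4"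
      by (auto simp: eventually_sequentially)
    have "dist (s m) (s n) < e" if "m \<ge> N" "n \<ge> N" for m n
    proof -
      have "(dist (s m) (s n))\<^sup>2 < e\<^sup>2" using par[of m n] N[OF that(1)] N[OF that(2)] by linarith
      then show ?thesis using e by (simp add: power2_less_imp_less)
    qed
    then show "\<exists>M. \<forall>m\<ge>M. \<forall>n\<ge>M. dist (s m) (s n) < e" by blast
  qed
  then obtain p where p: "s \<longlonglongrightarrow> p" using Cauchy_convergent convergent_def by blast
  have pC: "p \<in> C" using closed_sequentially[OF assms(1) sC p] .
  have "dist x p = d"
    by (rule LIMSEQ_unique[OF tendsto_dist[OF tendsto_const p] lim])
  then show ?thesis using pC dle by auto
qed

lemma nearest_point_unique:
  fixes C :: "'a::{real_inner,complete_space} set"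
  assumes "closed C" "convex C"
    and "p \<in> C" "\<forall>y\<in>C. dist x p \<le> dist x y" "q \<in> C" "\<forall>y\<in>C. dist x q \<le> dist x y"
  shows "p = q"
proof -
  have "(x - p) \<bullet> (q - p) \<le> 0" "(x - q) \<bullet> (p - q) \<le> 0"
    using assms by (auto intro!: any_closest_point_dot)
  then have "(q - p) \<bullet> (q - p) \<le> 0"
    by (simp add: inner_diff_left inner_diff_right inner_commute)
  then have "(q - p) \<bullet> (q - p) = 0"
    by (rule order_antisym) (rule inner_ge_zero)
  then show ?thesis by simp
qed

lemma proj_eq_iff:
  fixes C :: "'a::{real_inner,complete_space} set"
  assumes "closed C" "convex C" "C \<noteq> {}"
  shows "proj C x = p \<longleftrightarrow> p \<in> C \<and> (\<forall>y\<in>C. dist x p \<le> dist x y)"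
proof -
  have "\<exists>!p. p \<in> C \<and> (\<forall>y\<in>C. dist x p \<le> dist x y)"
    using nearest_point_exists[OF assms] nearest_point_unique[OF assms(1,2)] by metis
  from theI'[OF this] this show ?thesis unfolding proj_def by blast
qed

lemma argmin_gap_objective:
  fixes C1 C2 :: "'a::{real_inner,complete_space} set"
  assumes "convex C1" "C1 \<noteq> {}" "convex C2" "C2 \<noteq> {}"
  defines "D \<equiv> closure {y - x | x y. x \<in> C1 \<and> y \<in> C2}"
  shows "argmin (gap_objective C1 C2) = {- proj D 0}"
proof -
  define D0 where "D0 = {y - x | x y. x \<in> C1 \<and> y \<in> C2}"
  define v where "v = proj D 0"
  have DD0: "D = closure D0" by (simp add: D_def D0_def)
  have "D0 = (\<Union>y\<in>C2. \<Union>x\<in>C1. {y - x})" by (auto simp: D0_def)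
  then have "convex D0" using convex_differences[OF assms(3,1)] by simp
  then have D: "closed D" "convex D" "D \<noteq> {}"
    using assms(2,4) by (auto simp: DD0 convex_closure D0_def)
  have v: "v \<in> D" "\<forall>y\<in>D. dist 0 v \<le> dist 0 y"
    using proj_eq_iff[OF D] v_def by blast+
  have vd: "v \<bullet> v \<le> v \<bullet> d" if "d \<in> D0" for d
    using any_closest_point_dot[OF D(2,1) v(1) _ v(2), of d] that closure_subset[of D0]
    by (auto simp: DD0 inner_diff_right)
  have lower: "ereal (\<phi> \<bullet> v) \<le> support_fun D0 \<phi>" for \<phi>
  proof -
    from v(1) obtain s where s: "\<And>n. s n \<in> D0" "s \<longlonglongrightarrow> v"
      unfolding DD0 closure_sequential by blast
    have "(\<lambda>n. ereal (\<phi> \<bullet> s n)) \<longlonglongrightarrow> ereal (\<phi> \<bullet> v)"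
      using s(2) by (auto intro!: tendsto_intros)
    then show ?thesis
      by (rule LIMSEQ_le_const2) (auto simp: support_fun_def intro!: SUP_upper s)
  qed
  have at_v: "support_fun D0 (- v) \<le> ereal (- (v \<bullet> v))"
    unfolding support_fun_def by (rule SUP_least) (simp add: vd)
  let ?J = "gap_objective C1 C2"
  have J: "?J \<phi> = support_fun D0 \<phi> + ereal (1/2 * (norm \<phi>)\<^sup>2)" for \<phi>
    by (simp add: gap_objective_def D0_def)
  have Jlow: "ereal (1/2 * (norm (\<phi> + v))\<^sup>2 - 1/2 * (v \<bullet> v)) \<le> ?J \<phi>" for \<phi>
  proof -
    have "1/2 * (norm (\<phi> + v))\<^sup>2 - 1/2 * (v \<bullet> v) = \<phi> \<bullet> v + 1/2 * (norm \<phi>)\<^sup>2"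
      by (simp add: power2_norm_eq_inner inner_add_left inner_add_right inner_commute field_simps)
    then have "ereal (1/2 * (norm (\<phi> + v))\<^sup>2 - 1/2 * (v \<bullet> v))
        = ereal (\<phi> \<bullet> v) + ereal (1/2 * (norm \<phi>)\<^sup>2)"
      by (simp only: plus_ereal.simps)
    also have "\<dots> \<le> ?J \<phi>" unfolding J by (rule add_right_mono[OF lower])
    finally show ?thesis .
  qed
  have Jv: "?J (- v) \<le> ereal (- 1/2 * (v \<bullet> v))"
    using add_right_mono[OF at_v, of "ereal (1/2 * (norm (- v))\<^sup>2)"]
    by (simp add: J power2_norm_eq_inner)
  have "- v \<in> argmin ?J"
  proof -
    have "?J (- v) \<le> ?J \<phi>" for \<phi>
    proof -
      have "ereal (- 1/2 * (v \<bullet> v)) \<le> ereal (1/2 * (norm (\<phi> + v))\<^sup>2 - 1/2 * (v \<bullet> v))" by simp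
      from order_trans[OF Jv order_trans[OF this Jlow]] show ?thesis .
    qed
    then show ?thesis by (simp add: argmin_def)
  qed
  moreover have "\<phi> = - v" if "\<phi> \<in> argmin ?J" for \<phi>
  proof -
    have "?J \<phi> \<le> ?J (- v)" using that by (simp add: argmin_def)
    from order_trans[OF Jlow order_trans[OF this Jv]]
    have "ereal (1/2 * (norm (\<phi> + v))\<^sup>2 - 1/2 * (v \<bullet> v)) \<le> ereal (- 1/2 * (v \<bullet> v))" .
    then show ?thesis by (simp add: eq_neg_iff_add_eq_0)
  qed
  ultimately show ?thesis unfolding v_def by blast
qed

corollary argmin_gap_objective_eq_gap_vector:
  fixes C1 C2 :: "'a::{real_inner,complete_space} set"
  assumes "convex C1" "C1 \<noteq> {}" "convex C2" "C2 \<noteq> {}"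
  shows "argmin (gap_objective C1 C2) = {gap_vector C1 C2}"
  unfolding gap_vector_def argmin_gap_objective[OF assms] by simp

end

theory Submission
  imports Defs
begin

text \<open>
  Everything reduces to one vector. The gap vector \<open>\<phi>\<close> is, up to sign, the shortest element of the
  closure of \<open>C2 - C1\<close>, so no difference \<open>x - y\<close> with \<open>x \<in> C1\<close>, \<open>y \<in> C2\<close> is shorter than \<open>\<phi>\<close>, and the
  only difference that can attain its length is \<open>\<phi>\<close> itself. By the variational characterization
  of projections, a pair \<open>(x, y)\<close> whose members are projections of each other is a pair of points
  of \<open>C1\<close> and \<open>C2\<close> at least distance; thus \<open>S\<close> is the set of pairs in \<open>C1 \<times> C2\<close> with \<open>x - y = \<phi>\<close>
  (\<open>mutual_proj_iff_gap\<close>), and \<open>E\<close> and \<open>F\<close> are its two coordinate projections.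

  If \<open>z\<close> is the average of its two projections \<open>x\<close> and \<open>y\<close>, then \<open>z\<close> lies on the segment from \<open>x\<close> to
  \<open>y\<close>. A projection onto a convex set does not change when the point moves along a ray issuing from
  its projection, so \<open>x\<close> and \<open>y\<close> are projections of each other, and the converse holds for the
  same reason (\<open>average_proj_iff_gap\<close>). Hence on \<open>S\<close>, \<open>E\<close>, \<open>F\<close> and the fixed point set of the averaged
  projection, all maps of the theorem are restrictions of continuous affine maps, mostly
  translations by multiples of \<open>\<phi>\<close>, so being a homeomorphism is a matter of bookkeeping.
  The last part follows from convexity of \<open>C1\<close> and \<open>C2\<close>: a translate by \<open>\<phi>\<close> moves any point of \<open>E\<close> to
  one of \<open>F\<close>, so points of \<open>E\<close> and \<open>F\<close> can be combined even if they do not form a pair in \<open>S\<close>.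

  For the argmin identities, the length of \<open>\<phi>\<close> gives a lower bound for each functional, and it is
  attained on the fixed point sets. Conversely, a minimizer of \<open>g\<close> is a pair at least distance, a
  minimizer of \<open>g1\<close> must be a nearest point of \<open>C1\<close> to its own projection onto \<open>C2\<close> (and likewise for
  \<open>g2\<close>), and a minimizer of \<open>g3\<close> must equal the average of its projections, since otherwise that
  average would have a smaller value.
\<close>

section \<open>Projections onto closed convex sets\<close>

lemma proj_eq_iff_inner:
  fixes C :: "'a::{real_inner,complete_space} set"
  assumes "closed C" "convex C" "C \<noteq> {}"
  shows "proj C u = p \<longleftrightarrow> p \<in> C \<and> (\<forall>y\<in>C. (u - p) \<bullet> (y - p) \<le> 0)"
proof
  assume "proj C u = p"
  then have "p \<in> C" "\<forall>y\<in>C. dist u p \<le> dist u y"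
    using proj_eq_iff[OF assms] by blast+
  then show "p \<in> C \<and> (\<forall>y\<in>C. (u - p) \<bullet> (y - p) \<le> 0)"
    using any_closest_point_dot[OF assms(2,1)] by blast
next
  assume p: "p \<in> C \<and> (\<forall>y\<in>C. (u - p) \<bullet> (y - p) \<le> 0)"
  have "dist u p \<le> dist u y" if "y \<in> C" for y
  proof -
    have "(norm (u - y))\<^sup>2 = (norm (u - p))\<^sup>2 + (norm (y - p))\<^sup>2 - 2 * ((u - p) \<bullet> (y - p))"
      by (simp add: power2_norm_eq_inner inner_diff_left inner_diff_right inner_commute)
    moreover have "(u - p) \<bullet> (y - p) \<le> 0" using p that by blast
    ultimately have "(norm (u - p))\<^sup>2 \<le> (norm (u - y))\<^sup>2"
      using zero_le_power2[of "norm (y - p)"] by linarith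
    then show ?thesis by (simp add: dist_norm)
  qed
  then show "proj C u = p" using p proj_eq_iff[OF assms] by blast
qed

text \<open>The points projected to \<open>p\<close> form a cone with apex \<open>p\<close> (the normal cone at \<open>p\<close>, translated):
  scaling \<open>u - p\<close> by a positive factor does not affect the variational inequality.\<close>

lemma proj_ray:
  fixes C :: "'a::{real_inner,complete_space} set"
  assumes "closed C" "convex C" "C \<noteq> {}"
    and "t > 0" and "v - p = t *\<^sub>R (u - p)"
  shows "proj C v = p \<longleftrightarrow> proj C u = p"
  using assms(4) by (simp add: proj_eq_iff_inner[OF assms(1-3)] assms(5) mult_le_0_iff)

lemma infdist_eq_norm_proj:
  fixes C :: "'a::{real_inner,complete_space} set"
  assumes "closed C" "convex C" "C \<noteq> {}"
  shows "infdist x C = norm (x - proj C x)"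
proof -
  have p: "proj C x \<in> C" "\<forall>y\<in>C. dist x (proj C x) \<le> dist x y"
    using proj_eq_iff[OF assms] by blast+
  have "dist x (proj C x) \<le> infdist x C"
    unfolding infdist_notempty[OF assms(3)] using p(2) assms(3) by (intro cINF_greatest) auto
  then show ?thesis using infdist_le[OF p(1), of x] by (simp add: dist_norm)
qed

section \<open>Pairs of points that realize the gap\<close>

locale closed_convex_pair =
  fixes C1 C2 :: "'a::{real_inner,complete_space} set"
  assumes C1: "closed C1" "convex C1" "C1 \<noteq> {}"
    and C2: "closed C2" "convex C2" "C2 \<noteq> {}"
begin

abbreviation "gap \<equiv> gap_vector C1 C2"

lemma proj_mem: "proj C1 u \<in> C1" "proj C2 u \<in> C2"
  using proj_eq_iff[OF C1] proj_eq_iff[OF C2] by blast+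

lemma minus_gap_eq_proj:
  "- gap = proj (closure {y - x | x y. x \<in> C1 \<and> y \<in> C2}) 0"
  using argmin_gap_objective[OF C1(2,3) C2(2,3)]
    argmin_gap_objective_eq_gap_vector[OF C1(2,3) C2(2,3)] by simp

lemma closure_differences:
  defines "D \<equiv> closure {y - x | x y. x \<in> C1 \<and> y \<in> C2}"
  shows "closed D" "convex D" "D \<noteq> {}"
proof -
  have "{y - x | x y. x \<in> C1 \<and> y \<in> C2} = (\<Union>y\<in>C2. \<Union>x\<in>C1. {y - x})" by auto
  then show "convex D"
    using convex_differences[OF C2(2) C1(2)] by (simp add: D_def convex_closure)
qed (use C1(3) C2(3) in \<open>auto simp: D_def\<close>)

lemma norm_gap_le:
  assumes "x \<in> C1" "y \<in> C2"
  shows "norm gap \<le> norm (x - y)"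
proof -
  have "y - x \<in> closure {y - x | x y. x \<in> C1 \<and> y \<in> C2}"
    by (rule subsetD[OF closure_subset]) (use assms in blast)
  then have "dist 0 (- gap) \<le> dist 0 (y - x)"
    using iffD1[OF proj_eq_iff[OF closure_differences] minus_gap_eq_proj[symmetric]] by simp
  then show ?thesis by (simp add: norm_minus_commute)
qed

text \<open>A shortest difference is also shortest in the closure, where the shortest element is
  unique. The closure is what makes \<open>gap\<close> meaningful even if no difference attains its length.\<close>

lemma shortest_difference_eq_gap:
  assumes "x \<in> C1" "y \<in> C2"
    and min: "\<And>x' y'. x' \<in> C1 \<Longrightarrow> y' \<in> C2 \<Longrightarrow> norm (x - y) \<le> norm (x' - y')"
  shows "x - y = gap"
proof -
  let ?D = "{y - x | x y. x \<in> C1 \<and> y \<in> C2}"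
  have "y - x \<in> closure ?D"
    by (rule subsetD[OF closure_subset]) (use assms(1,2) in blast)
  moreover have "closure ?D \<subseteq> {d. norm (x - y) \<le> norm d}"
  proof (rule closure_minimal)
    show "?D \<subseteq> {d. norm (x - y) \<le> norm d}"
      using min by (auto simp: norm_minus_commute)
    show "closed {d :: 'a. norm (x - y) \<le> norm d}"
      by (intro closed_Collect_le continuous_intros)
  qed
  ultimately have "proj (closure ?D) 0 = y - x"
    unfolding proj_eq_iff[OF closure_differences]
    by (simp add: subset_iff norm_minus_commute[of y x])
  then have "- gap = y - x" unfolding minus_gap_eq_proj .
  then have "- (- gap) = - (y - x)" by (rule arg_cong)
  then show ?thesis by simp
qed

text \<open>Mutual projections minimize the distance between the sets: adding the two variational
  inequalities shows that \<open>y - x\<close> has inner product at least \<open>\<parallel>y - x\<parallel>\<^sup>2\<close> with every other difference,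
  and Cauchy--Schwarz turns this into a comparison of norms.\<close>

lemma mutual_proj_iff_gap:
  "x = proj C1 y \<and> y = proj C2 x \<longleftrightarrow> x \<in> C1 \<and> y \<in> C2 \<and> x - y = gap"
proof
  assume a: "x = proj C1 y \<and> y = proj C2 x"
  then have x: "x \<in> C1" "\<And>x'. x' \<in> C1 \<Longrightarrow> (y - x) \<bullet> (x' - x) \<le> 0"
    using proj_eq_iff_inner[OF C1, of y x] by metis+
  have y: "y \<in> C2" "\<And>y'. y' \<in> C2 \<Longrightarrow> (x - y) \<bullet> (y' - y) \<le> 0"
    using a proj_eq_iff_inner[OF C2, of x y] by metis+
  have "norm (x - y) \<le> norm (x' - y')" if "x' \<in> C1" "y' \<in> C2" for x' y'
  proof -
    have "norm (x - y) * norm (x - y) \<le> (x - y) \<bullet> (x' - y')"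
      using x(2)[OF that(1)] y(2)[OF that(2)]
      by (simp add: power2_norm_eq_inner[symmetric] power2_eq_square[symmetric])
        (simp add: power2_norm_eq_inner inner_diff_left inner_diff_right inner_commute)
    also have "\<dots> \<le> norm (x - y) * norm (x' - y')" by (rule norm_cauchy_schwarz)
    finally show ?thesis
      by (cases "x = y") (auto simp: mult_le_cancel_left)
  qed
  then show "x \<in> C1 \<and> y \<in> C2 \<and> x - y = gap"
    using shortest_difference_eq_gap x(1) y(1) by blast
next
  assume a: "x \<in> C1 \<and> y \<in> C2 \<and> x - y = gap"
  have "proj C1 y = x"
    using a norm_gap_le by (auto simp: proj_eq_iff[OF C1] dist_norm norm_minus_commute)
  moreover have "proj C2 x = y"
    using a norm_gap_le by (auto simp: proj_eq_iff[OF C2] dist_norm)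
  ultimately show "x = proj C1 y \<and> y = proj C2 x" by simp
qed

lemma mutual_proj_of_gap:
  assumes "x \<in> C1" "y \<in> C2" "x - y = gap"
  shows "proj C1 y = x" "proj C2 x = y"
  using mutual_proj_iff_gap[of x y] assms by metis+

lemma Fix_proj_comp_iff_gap:
  "x \<in> Fix (proj C1 \<circ> proj C2) \<longleftrightarrow> x \<in> C1 \<and> x - gap \<in> C2"
proof
  assume "x \<in> Fix (proj C1 \<circ> proj C2)"
  then have "x \<in> C1 \<and> proj C2 x \<in> C2 \<and> x - proj C2 x = gap"
    using mutual_proj_iff_gap[of x "proj C2 x"] by (simp add: Fix_def)
  then show "x \<in> C1 \<and> x - gap \<in> C2" by (metis add_diff_cancel_left' diff_add_cancel)
qed (use mutual_proj_of_gap[of x "x - gap"] in \<open>simp add: Fix_def\<close>)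

lemma Fix_proj_comp_iff_gap':
  "y \<in> Fix (proj C2 \<circ> proj C1) \<longleftrightarrow> y \<in> C2 \<and> y + gap \<in> C1"
proof
  assume "y \<in> Fix (proj C2 \<circ> proj C1)"
  then have "proj C1 y \<in> C1 \<and> y \<in> C2 \<and> proj C1 y - y = gap"
    using mutual_proj_iff_gap[of "proj C1 y" y] by (simp add: Fix_def)
  then show "y \<in> C2 \<and> y + gap \<in> C1" by (metis add.commute diff_add_cancel)
qed (use mutual_proj_of_gap[of "y + gap" y] in \<open>simp add: Fix_def\<close>)

section \<open>Fixed points of averaged projections\<close>

text \<open>With \<open>x = proj C1 z\<close> and \<open>y = proj C2 z\<close>, the fixed point equation says that \<open>z - x = l2 (y - x)\<close> and
  \<open>z - y = l1 (x - y)\<close>. By \<open>proj_ray\<close>, the points \<open>z\<close> and \<open>y\<close> then have the same projection \<open>x\<close> onto \<open>C1\<close>,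
  and \<open>z\<close> and \<open>x\<close> the same projection \<open>y\<close> onto \<open>C2\<close>. Starting from a pair with difference \<open>gap\<close>, the same
  rays are followed in the opposite direction.\<close>

lemma average_proj_iff_gap:
  assumes l: "l1 > 0" "l2 > 0" "l1 + l2 = 1"
  shows "z = l1 *\<^sub>R proj C1 z + l2 *\<^sub>R proj C2 z \<longleftrightarrow> z + l2 *\<^sub>R gap \<in> C1 \<and> z - l1 *\<^sub>R gap \<in> C2"
    (is "?fixed \<longleftrightarrow> ?shifted")
    and "z = l1 *\<^sub>R proj C1 z + l2 *\<^sub>R proj C2 z \<Longrightarrow> proj C1 z = z + l2 *\<^sub>R gap"
    and "z = l1 *\<^sub>R proj C1 z + l2 *\<^sub>R proj C2 z \<Longrightarrow> proj C2 z = z - l1 *\<^sub>R gap"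
proof -
  have l1: "l1 = 1 - l2" using l(3) by simp
  have eq: "proj C1 z = z + l2 *\<^sub>R gap" "proj C2 z = z - l1 *\<^sub>R gap" if ?fixed
  proof -
    define x y where "x = proj C1 z" and "y = proj C2 z"
    have z: "z = l1 *\<^sub>R x + l2 *\<^sub>R y" using that by (simp add: x_def y_def)
    have zx: "z - x = l2 *\<^sub>R (y - x)" and zy: "z - y = l1 *\<^sub>R (x - y)"
      unfolding z l1 by (simp_all add: algebra_simps)
    have "proj C1 y = x" using proj_ray[OF C1 l(2) zx] by (simp add: x_def)
    moreover have "proj C2 x = y" using proj_ray[OF C2 l(1) zy] by (simp add: y_def)
    ultimately have "x - y = gap" using mutual_proj_iff_gap[of x y] by simp
    then have "x = z + l2 *\<^sub>R gap" "y = z - l1 *\<^sub>R gap"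
      using zx zy by (simp_all add: algebra_simps)
    then show "proj C1 z = z + l2 *\<^sub>R gap" "proj C2 z = z - l1 *\<^sub>R gap"
      by (simp_all only: x_def y_def)
  qed
  have fixed: ?fixed if ?shifted
  proof -
    define x y where "x = z + l2 *\<^sub>R gap" and "y = z - l1 *\<^sub>R gap"
    have xy: "x - y = gap" by (simp add: x_def y_def l1 algebra_simps)
    have m: "proj C1 y = x" "proj C2 x = y"
      using mutual_proj_of_gap[OF _ _ xy] that by (auto simp: x_def y_def)
    have "y - x = - gap" using xy by (metis minus_diff_eq)
    then have zx: "z - x = l2 *\<^sub>R (y - x)" by (simp add: x_def)
    have zy: "z - y = l1 *\<^sub>R (x - y)" by (simp add: xy) (simp add: y_def)
    have "proj C1 z = x" using proj_ray[OF C1 l(2) zx] m by simp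
    moreover have "proj C2 z = y" using proj_ray[OF C2 l(1) zy] m by simp
    moreover have "z = l1 *\<^sub>R x + l2 *\<^sub>R y" by (simp add: x_def y_def l1 algebra_simps)
    ultimately show ?fixed by (simp only:)
  qed
  show "?fixed \<longleftrightarrow> ?shifted"
    using eq fixed proj_mem[of z] by metis
  show "?fixed \<Longrightarrow> proj C1 z = z + l2 *\<^sub>R gap" "?fixed \<Longrightarrow> proj C2 z = z - l1 *\<^sub>R gap"
    by (fact eq)+
qed

lemma average_proj_of_mutual_proj:
  assumes l: "l1 > 0" "l2 > 0" "l1 + l2 = 1"
    and xy: "x \<in> C1" "y \<in> C2" "x - y = gap"
  defines "z \<equiv> l1 *\<^sub>R x + l2 *\<^sub>R y"
  shows "z = l1 *\<^sub>R proj C1 z + l2 *\<^sub>R proj C2 z" "proj C1 z = x" "proj C2 z = y"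
proof -
  have l1: "l1 = 1 - l2" using l(3) by simp
  have x: "z + l2 *\<^sub>R gap = x" and y: "z - l1 *\<^sub>R gap = y"
    by (simp_all add: z_def xy(3)[symmetric] l1 algebra_simps)
  show fixed: "z = l1 *\<^sub>R proj C1 z + l2 *\<^sub>R proj C2 z"
    using average_proj_iff_gap(1)[OF l, of z] xy by (simp add: x y)
  show "proj C1 z = x" "proj C2 z = y"
    using average_proj_iff_gap(2,3)[OF l fixed] by (simp_all add: x y)
qed

section \<open>Minimizers\<close>

lemma argmin_pair_distance:
  "argmin (\<lambda>(x, y). iota C1 x + iota C2 y + ereal (1/2 * (norm (x - y))\<^sup>2))
    = {(x, y). x = proj C1 y \<and> y = proj C2 x}" (is "argmin ?g = _")
proof -
  have "(x, y) \<in> argmin ?g \<longleftrightarrow> x \<in> C1 \<and> y \<in> C2 \<and> x - y = gap" for x y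
  proof
    assume "(x, y) \<in> argmin ?g"
    then have min: "?g (x, y) \<le> ?g (x', y')" for x' y' unfolding argmin_def by blast
    obtain a b where "a \<in> C1" "b \<in> C2" using C1(3) C2(3) by blast
    then have xy: "x \<in> C1" "y \<in> C2"
      using min[of a b] by (auto simp: iota_def split: if_splits)
    have "norm (x - y) \<le> norm (x' - y')" if "x' \<in> C1" "y' \<in> C2" for x' y'
      using min[of x' y'] xy that by (simp add: iota_def)
    then show "x \<in> C1 \<and> y \<in> C2 \<and> x - y = gap"
      using xy shortest_difference_eq_gap by blast
  next
    assume "x \<in> C1 \<and> y \<in> C2 \<and> x - y = gap"
    then show "(x, y) \<in> argmin ?g"
      using norm_gap_le by (auto simp: argmin_def iota_def)
  qed
  then show ?thesis unfolding mutual_proj_iff_gap by auto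
qed

lemma argmin_distance_to_second:
  "argmin (\<lambda>x. iota C1 x + ereal (1/2 * (infdist x C2)\<^sup>2)) = Fix (proj C1 \<circ> proj C2)"
  (is "argmin ?g = _")
proof (intro set_eqI iffI)
  fix x assume "x \<in> argmin ?g"
  then have min: "?g x \<le> ?g x'" for x' unfolding argmin_def by blast
  obtain a where "a \<in> C1" using C1(3) by blast
  then have x: "x \<in> C1" using min[of a] by (auto simp: iota_def split: if_splits)
  have "dist (proj C2 x) x \<le> dist (proj C2 x) x'" if "x' \<in> C1" for x'
  proof -
    have "norm (x - proj C2 x) = infdist x C2" by (simp add: infdist_eq_norm_proj[OF C2])
    also have "\<dots> \<le> infdist x' C2"
      using min[of x'] x that by (simp add: iota_def infdist_nonneg)
    also have "\<dots> \<le> dist x' (proj C2 x)" by (rule infdist_le[OF proj_mem(2)])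
    finally show ?thesis by (simp add: dist_norm norm_minus_commute)
  qed
  then show "x \<in> Fix (proj C1 \<circ> proj C2)"
    using x by (simp add: Fix_def proj_eq_iff[OF C1])
next
  fix x assume "x \<in> Fix (proj C1 \<circ> proj C2)"
  then have x: "x \<in> C1" "x - gap \<in> C2" by (simp_all add: Fix_proj_comp_iff_gap)
  have "infdist x C2 \<le> infdist x' C2" if "x' \<in> C1" for x'
  proof -
    have "infdist x C2 \<le> norm gap" using infdist_le[OF x(2), of x] by (simp add: dist_norm)
    also have "\<dots> \<le> infdist x' C2"
      using norm_gap_le[OF that proj_mem(2)] by (simp add: infdist_eq_norm_proj[OF C2])
    finally show ?thesis .
  qed
  then show "x \<in> argmin ?g"
    using x(1) by (auto simp: argmin_def iota_def infdist_nonneg intro!: power_mono)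
qed

text \<open>The reason is the identity
  \<open>l1 \<parallel>z - x\<parallel>\<^sup>2 + l2 \<parallel>z - y\<parallel>\<^sup>2 = \<parallel>z - (l1 x + l2 y)\<parallel>\<^sup>2 + l1 l2 \<parallel>x - y\<parallel>\<^sup>2\<close>
  for \<open>x = proj C1 z\<close> and \<open>y = proj C2 z\<close>. At a minimizer the first square on the right vanishes, since
  passing from \<open>z\<close> to \<open>l1 x + l2 y\<close> would remove it; at a fixed point it vanishes and the second one
  is as small as the gap permits.\<close>

lemma argmin_average_distance:
  assumes l: "l1 > 0" "l2 > 0" "l1 + l2 = 1"
  shows "argmin (\<lambda>z. l1 * (1/2 * (infdist z C1)\<^sup>2) + l2 * (1/2 * (infdist z C2)\<^sup>2))
    = {z. z = l1 *\<^sub>R proj C1 z + l2 *\<^sub>R proj C2 z}" (is "argmin ?g = _")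
proof -
  have l2: "l2 = 1 - l1" using l(3) by simp
  have split: "l1 * (1/2 * (norm (z - x))\<^sup>2) + l2 * (1/2 * (norm (z - y))\<^sup>2)
      = 1/2 * (norm (z - (l1 *\<^sub>R x + l2 *\<^sub>R y)))\<^sup>2 + l1 * l2 / 2 * (norm (x - y))\<^sup>2" for x y z :: 'a
    unfolding l2 power2_norm_eq_inner
    by (simp add: inner_diff_left inner_diff_right inner_add_left inner_add_right
        inner_commute) (simp add: field_simps)
  have g: "?g z = 1/2 * (norm (z - (l1 *\<^sub>R proj C1 z + l2 *\<^sub>R proj C2 z)))\<^sup>2
      + l1 * l2 / 2 * (norm (proj C1 z - proj C2 z))\<^sup>2" for z
    unfolding infdist_eq_norm_proj[OF C1] infdist_eq_norm_proj[OF C2] by (rule split)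
  have g_le: "?g z \<le> l1 * (1/2 * (norm (z - x))\<^sup>2) + l2 * (1/2 * (norm (z - y))\<^sup>2)"
    if "x \<in> C1" "y \<in> C2" for x y z
    using infdist_le[OF that(1), of z] infdist_le[OF that(2), of z] l
    by (intro add_mono mult_left_mono power_mono) (auto simp: dist_norm infdist_nonneg)
  show ?thesis
  proof (intro set_eqI iffI)
    fix z assume "z \<in> argmin ?g"
    then have min: "?g z \<le> ?g z'" for z' unfolding argmin_def by blast
    define x y where "x = proj C1 z" and "y = proj C2 z"
    define w where "w = l1 *\<^sub>R x + l2 *\<^sub>R y"
    have "?g z \<le> ?g w" by (rule min)
    also have "\<dots> \<le> l1 * (1/2 * (norm (w - x))\<^sup>2) + l2 * (1/2 * (norm (w - y))\<^sup>2)"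
      by (rule g_le) (simp_all add: x_def y_def proj_mem)
    also have "\<dots> = l1 * l2 / 2 * (norm (x - y))\<^sup>2"
      unfolding split by (simp add: w_def)
    finally have "(norm (z - w))\<^sup>2 \<le> 0"
      unfolding g x_def[symmetric] y_def[symmetric] w_def[symmetric] by simp
    then show "z \<in> {z. z = l1 *\<^sub>R proj C1 z + l2 *\<^sub>R proj C2 z}"
      by (simp add: w_def x_def y_def)
  next
    fix z assume "z \<in> {z. z = l1 *\<^sub>R proj C1 z + l2 *\<^sub>R proj C2 z}"
    then have z: "z = l1 *\<^sub>R proj C1 z + l2 *\<^sub>R proj C2 z" by simp
    have "proj C1 z - proj C2 z = (l1 + l2) *\<^sub>R gap"
      using average_proj_iff_gap(2,3)[OF l z] by (simp add: algebra_simps)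
    then have gz: "?g z = l1 * l2 / 2 * (norm gap)\<^sup>2"
      unfolding g z[symmetric] by (simp add: l(3))
    have "?g z \<le> ?g z'" for z'
    proof -
      have "l1 * l2 / 2 * (norm gap)\<^sup>2 \<le> l1 * l2 / 2 * (norm (proj C1 z' - proj C2 z'))\<^sup>2"
        using l norm_gap_le[OF proj_mem] by (intro mult_left_mono power_mono) auto
      then show ?thesis unfolding gz unfolding g[of z'] by (simp add: add_increasing)
    qed
    then show "z \<in> argmin ?g" by (simp add: argmin_def)
  qed
qed

end

text \<open>Exchanging the two sets turns \<open>argmin_distance_to_second\<close> into the statement about \<open>g2\<close>.\<close>

lemma closed_convex_pair_swap: "closed_convex_pair C1 C2 \<Longrightarrow> closed_convex_pair C2 C1"
  by (simp add: closed_convex_pair_def)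

section \<open>The correspondence between the solution sets\<close>

theorem theorem4p19:
  fixes C1 C2 :: "'a::{real_inner,complete_space} set"
    and l1 l2 :: real
  assumes "C1 \<noteq> {}" "closed C1" "convex C1"
    and "C2 \<noteq> {}" "closed C2" "convex C2"
    and "l1 > 0" "l2 > 0" "l1 + l2 = 1"
  defines "P1 \<equiv> proj C1" and "P2 \<equiv> proj C2"
  defines "g \<equiv> \<lambda>(x, y). iota C1 x + iota C2 y + ereal (1/2 * (norm (x - y))\<^sup>2)"
    and "g1 \<equiv> \<lambda>x. iota C1 x + ereal (1/2 * (infdist x C2)\<^sup>2)"
    and "g2 \<equiv> \<lambda>y. ereal (1/2 * (infdist y C1)\<^sup>2) + iota C2 y"
    and "g3 \<equiv> \<lambda>z. l1 * (1/2 * (infdist z C1)\<^sup>2) + l2 * (1/2 * (infdist z C2)\<^sup>2)"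
  defines "S \<equiv> {(x, y). x = P1 y \<and> y = P2 x}"
    and "E \<equiv> Fix (P1 \<circ> P2)"
    and "F \<equiv> Fix (P2 \<circ> P1)"
    and "A \<equiv> Fix (\<lambda>z. l1 *\<^sub>R P1 z + l2 *\<^sub>R P2 z)"
    and "\<phi> \<equiv> gap_vector C1 C2"
  defines "L \<equiv> \<lambda>(x, y). l1 *\<^sub>R x + l2 *\<^sub>R y"
    and "H1 \<equiv> \<lambda>x. l1 *\<^sub>R x + l2 *\<^sub>R P2 x"
    and "H2 \<equiv> \<lambda>y. l1 *\<^sub>R P1 y + l2 *\<^sub>R y"
  shows "S = argmin g \<and> E = argmin g1 \<and> F = argmin g2
      \<and> argmin g3 = {z. z = l1 *\<^sub>R P1 z + l2 *\<^sub>R P2 z}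
    \<and> (homeomorphism S A L (\<lambda>z. (P1 z, P2 z)) \<and> A = L ` S)
    \<and> (homeomorphism E A H1 P1 \<and> (\<forall>x\<in>E. H1 x = x - l2 *\<^sub>R \<phi>) \<and> A = (\<lambda>x. x - l2 *\<^sub>R \<phi>) ` E)
    \<and> (homeomorphism F A H2 P2 \<and> (\<forall>y\<in>F. H2 y = l1 *\<^sub>R \<phi> + y) \<and> A = (\<lambda>y. y + l1 *\<^sub>R \<phi>) ` F)
    \<and> A = {l1 *\<^sub>R x + l2 *\<^sub>R y | x y. x \<in> E \<and> y \<in> F}"
proof -
  interpret closed_convex_pair C1 C2 by unfold_locales (use assms(1-6) in auto)
  interpret swap: closed_convex_pair C2 C1
    by (rule closed_convex_pair_swap) unfold_locales
  note l = assms(7-9)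
  have l1: "l1 = 1 - l2" using l(3) by simp

  \<comment> \<open>Membership in \<open>C1\<close> and \<open>C2\<close> up to translation by \<open>\<phi>\<close> replaces all fixed point equations.\<close>
  have S: "(x, y) \<in> S \<longleftrightarrow> x \<in> C1 \<and> y \<in> C2 \<and> x - y = \<phi>" for x y
    unfolding S_def P1_def P2_def \<phi>_def using mutual_proj_iff_gap by simp
  have E: "x \<in> E \<longleftrightarrow> x \<in> C1 \<and> x - \<phi> \<in> C2" for x
    unfolding E_def P1_def P2_def \<phi>_def by (rule Fix_proj_comp_iff_gap)
  have F: "y \<in> F \<longleftrightarrow> y \<in> C2 \<and> y + \<phi> \<in> C1" for y
    unfolding F_def P1_def P2_def \<phi>_def by (rule Fix_proj_comp_iff_gap')
  have A_eq: "z \<in> A \<longleftrightarrow> z = l1 *\<^sub>R P1 z + l2 *\<^sub>R P2 z" for z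
    by (auto simp: A_def Fix_def)
  have A: "z \<in> A \<longleftrightarrow> z + l2 *\<^sub>R \<phi> \<in> C1 \<and> z - l1 *\<^sub>R \<phi> \<in> C2" for z
    unfolding A_eq unfolding P1_def P2_def \<phi>_def by (rule average_proj_iff_gap(1)[OF l])

  \<comment> \<open>On these sets the projections that occur are translations.\<close>
  have A_P: "P1 z = z + l2 *\<^sub>R \<phi>" "P2 z = z - l1 *\<^sub>R \<phi>" if "z \<in> A" for z
    using average_proj_iff_gap(2,3)[OF l] that[unfolded A_eq]
    unfolding P1_def P2_def \<phi>_def by blast+
  have E_P: "P2 x = x - \<phi>" if "x \<in> E" for x
    using mutual_proj_of_gap(2)[of x "x - \<phi>"] that E by (simp add: P2_def \<phi>_def)
  have F_P: "P1 y = y + \<phi>" if "y \<in> F" for y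
    using mutual_proj_of_gap(1)[of "y + \<phi>" y] that F by (simp add: P1_def \<phi>_def)
  have H1: "H1 x = x - l2 *\<^sub>R \<phi>" if "x \<in> E" for x
    unfolding H1_def E_P[OF that] l1 by (simp add: algebra_simps)
  have H2: "H2 y = l1 *\<^sub>R \<phi> + y" if "y \<in> F" for y
    unfolding H2_def F_P[OF that] l1 by (simp add: algebra_simps)
  have shift1: "z + l2 *\<^sub>R \<phi> - \<phi> = z - l1 *\<^sub>R \<phi>" for z
    unfolding l1 by (simp add: algebra_simps)
  have shift2: "z - l1 *\<^sub>R \<phi> + \<phi> = z + l2 *\<^sub>R \<phi>" for z
    unfolding l1 by (simp add: algebra_simps)

  have cont_P: "continuous_on A P1" "continuous_on A P2"
  proof -
    have "continuous_on A (\<lambda>z. z + l2 *\<^sub>R \<phi>)" "continuous_on A (\<lambda>z. z - l1 *\<^sub>R \<phi>)"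
      by (intro continuous_intros)+
    then show "continuous_on A P1" "continuous_on A P2"
      using A_P by (simp_all cong: continuous_on_cong)
  qed

  have hom_S: "homeomorphism S A L (\<lambda>z. (P1 z, P2 z))"
  proof (rule homeomorphismI)
    show "continuous_on S L"
      unfolding L_def case_prod_unfold by (intro continuous_intros)
    show "continuous_on A (\<lambda>z. (P1 z, P2 z))"
      by (intro continuous_intros cont_P)
    show "L ` S \<subseteq> A"
    proof clarify
      fix x y assume "(x, y) \<in> S"
      then show "L (x, y) \<in> A"
        using average_proj_of_mutual_proj(1)[OF l, of x y]
        unfolding S A_eq L_def P1_def P2_def \<phi>_def by simp
    qed
    show "(\<lambda>z. (P1 z, P2 z)) ` A \<subseteq> S"
    proof (rule image_subsetI)
      fix z assume z: "z \<in> A"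
      have "z + l2 *\<^sub>R \<phi> - (z - l1 *\<^sub>R \<phi>) = \<phi>"
        unfolding l1 by (simp add: algebra_simps)
      then show "(P1 z, P2 z) \<in> S" using z by (simp add: S A_P) (simp add: A)
    qed
    show "(\<lambda>z. (P1 z, P2 z)) (L p) = p" if "p \<in> S" for p
      using that average_proj_of_mutual_proj(2,3)[OF l]
      by (cases p) (simp add: S L_def P1_def P2_def \<phi>_def)
    show "L (P1 z, P2 z) = z" if "z \<in> A" for z
      using that by (simp add: L_def A_eq)
  qed

  have img1: "A = (\<lambda>x. x - l2 *\<^sub>R \<phi>) ` E"
  proof -
    have "x - l2 *\<^sub>R \<phi> \<in> A" if "x \<in> E" for x
      using that by (simp add: E A shift1[symmetric])
    moreover have "z \<in> (\<lambda>x. x - l2 *\<^sub>R \<phi>) ` E" if "z \<in> A" for z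
      using that by (intro image_eqI[of _ _ "z + l2 *\<^sub>R \<phi>"]) (simp_all add: E A shift1)
    ultimately show ?thesis by blast
  qed
  have img2: "A = (\<lambda>y. y + l1 *\<^sub>R \<phi>) ` F"
  proof -
    have "y + l1 *\<^sub>R \<phi> \<in> A" if "y \<in> F" for y
      using that by (simp add: F A shift2[symmetric])
    moreover have "z \<in> (\<lambda>y. y + l1 *\<^sub>R \<phi>) ` F" if "z \<in> A" for z
      using that by (intro image_eqI[of _ _ "z - l1 *\<^sub>R \<phi>"]) (simp_all add: F A shift2)
    ultimately show ?thesis by blast
  qed

  have hom_E: "homeomorphism E A H1 P1"
  proof (rule homeomorphismI)
    have "continuous_on E (\<lambda>x. x - l2 *\<^sub>R \<phi>)" by (intro continuous_intros)
    then show "continuous_on E H1" using H1 by (simp cong: continuous_on_cong)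
    show "H1 ` E \<subseteq> A" using H1 img1 by auto
    show "P1 ` A \<subseteq> E" using A_P A by (auto simp: E shift1)
    show "P1 (H1 x) = x" if "x \<in> E" for x
      using that A_P(1)[of "H1 x"] H1[OF that] img1 by auto
    show "H1 (P1 z) = z" if "z \<in> A" for z
      using that H1[of "P1 z"] A by (simp add: A_P E shift1)
  qed (rule cont_P)
  have hom_F: "homeomorphism F A H2 P2"
  proof (rule homeomorphismI)
    have "continuous_on F (\<lambda>y. l1 *\<^sub>R \<phi> + y)" by (intro continuous_intros)
    then show "continuous_on F H2" using H2 by (simp cong: continuous_on_cong)
    show "H2 ` F \<subseteq> A" using H2 img2 by (auto simp: add.commute)
    show "P2 ` A \<subseteq> F" using A_P A by (auto simp: F shift2)
    show "P2 (H2 y) = y" if "y \<in> F" for y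
      using that A_P(2)[of "H2 y"] H2[OF that] img2 by (auto simp: add.commute)
    show "H2 (P2 z) = z" if "z \<in> A" for z
      using that H2[of "P2 z"] A by (simp add: A_P F shift2)
  qed (rule cont_P)

  have sum: "A = {l1 *\<^sub>R x + l2 *\<^sub>R y | x y. x \<in> E \<and> y \<in> F}"
  proof (intro set_eqI iffI)
    fix z assume "z \<in> A"
    then have "z = l1 *\<^sub>R P1 z + l2 *\<^sub>R P2 z" "P1 z \<in> E" "P2 z \<in> F"
      using A_eq homeomorphism_image2[OF hom_E] homeomorphism_image2[OF hom_F] by blast+
    then show "z \<in> {l1 *\<^sub>R x + l2 *\<^sub>R y | x y. x \<in> E \<and> y \<in> F}" by blast
  next
    fix z assume "z \<in> {l1 *\<^sub>R x + l2 *\<^sub>R y | x y. x \<in> E \<and> y \<in> F}"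
    then obtain x y where z: "z = l1 *\<^sub>R x + l2 *\<^sub>R y" and x: "x \<in> E" and y: "y \<in> F" by blast
    \<comment> \<open>The points \<open>x\<close> and \<open>y\<close> need not be partners, but \<open>x\<close> and the partner \<open>y + \<phi>\<close> of \<open>y\<close> both lie in
      \<open>C1\<close>, and the partner \<open>x - \<phi>\<close> of \<open>x\<close> and \<open>y\<close> both lie in \<open>C2\<close>.\<close>
    have "l1 *\<^sub>R x + l2 *\<^sub>R (y + \<phi>) \<in> C1" "l1 *\<^sub>R (x - \<phi>) + l2 *\<^sub>R y \<in> C2"
      using x y l by (auto simp: E F intro!: convexD[OF C1(2)] convexD[OF C2(2)])
    then show "z \<in> A" by (simp add: A z algebra_simps)
  qed

  have mins: "S = argmin g" "E = argmin g1" "F = argmin g2"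
    "argmin g3 = {z. z = l1 *\<^sub>R P1 z + l2 *\<^sub>R P2 z}"
    unfolding S_def E_def F_def g_def g1_def g2_def g3_def P1_def P2_def
    using argmin_pair_distance argmin_distance_to_second swap.argmin_distance_to_second
      argmin_average_distance[OF l]
    by (simp_all add: add.commute)

  show ?thesis
    by (intro conjI ballI mins hom_S homeomorphism_image1[OF hom_S, symmetric]
        hom_E H1 img1 hom_F H2 img2 sum)
qed

end
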